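(* Let $(G,+)$ be a finite abelian group and let $S\subseteq G$ be a nonempty subset. Then $$\frac{|H_G(S)|-1}{|H_G(S)|}|G|+1\le N_{G,S}\le \left\lfloor\frac{|S|-1}{|S|}|G|\right\rfloor+1.$$
   Context: For a finite abelian group $(G,+)$, an element $g\in G$ and a subset $S\subseteq G$, let $g+S=\{g+s: s\in S\}$. The stabilizer of $S$ is the subgroup $H_G(S)=\{g'\in G: g'+S=S\}$ of $G$. $N_{G,S}$ denotes the smallest integer $N\ge |S|$ such that for every subset $A\subseteq G$ with exactly $N$ elements there exists $g\in G$ with $g+S\subseteq A$. *)

theory Defs
  imports Complex_Main "HOL-Algebra.Group_Action"
begin

text \<open>
  The group is written multiplicatively, following \<^locale>\<open>comm_group\<close>; the translate
  $g + S$ is the library's \<open>g <# S\<close>, which is defined for arbitrary sets \<open>S\<close>,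
  not only for subgroups.
\<close>

definition set_stabilizer :: "('a, 'b) monoid_scheme \<Rightarrow> 'a set \<Rightarrow> 'a set" where
  "set_stabilizer G S = stabilizer G (l_coset G) S"

lemma set_stabilizer_iff:
  "h \<in> set_stabilizer G S \<longleftrightarrow> h \<in> carrier G \<and> h <#\<^bsub>G\<^esub> S = S"
  by (simp add: set_stabilizer_def stabilizer_def)

lemma (in group) set_stabilizer_subgroup:
  assumes "S \<subseteq> carrier G"
  shows "subgroup (set_stabilizer G S) G"
proof (rule subgroupI)
  show "set_stabilizer G S \<subseteq> carrier G"
    by (auto simp: set_stabilizer_iff)
  show "set_stabilizer G S \<noteq> {}"
    using assms by (auto simp: set_stabilizer_iff ex_in_conv[symmetric] lcos_mult_one)
next
  fix a assume "a \<in> set_stabilizer G S"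
  then have a: "a \<in> carrier G" "a <# S = S"
    by (auto simp: set_stabilizer_iff)
  have "inv a <# S = inv a <# (a <# S)"
    using a by simp
  also have "\<dots> = S"
    using assms a(1) by (simp add: lcos_m_assoc lcos_mult_one)
  finally show "inv a \<in> set_stabilizer G S"
    using a by (simp add: set_stabilizer_iff)
next
  fix a b assume "a \<in> set_stabilizer G S" "b \<in> set_stabilizer G S"
  then show "a \<otimes> b \<in> set_stabilizer G S"
    using assms by (auto simp: set_stabilizer_iff lcos_m_assoc[symmetric])
qed

definition forces_translate :: "('a, 'b) monoid_scheme \<Rightarrow> 'a set \<Rightarrow> nat \<Rightarrow> bool" where
  "forces_translate G S N \<longleftrightarrow>
     (\<forall>A. A \<subseteq> carrier G \<and> card A = N \<longrightarrow> (\<exists>g\<in>carrier G. g <#\<^bsub>G\<^esub> S \<subseteq> A))"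

definition translate_number :: "('a, 'b) monoid_scheme \<Rightarrow> 'a set \<Rightarrow> nat" where
  "translate_number G S = (LEAST N. card S \<le> N \<and> forces_translate G S N)"

text \<open>
  For finite \<open>G\<close> the \<open>LEAST\<close> is always attained, by a number that is at most
  the order of \<open>G\<close>, so that the condition on the sets \<open>A\<close> is not vacuous there.
\<close>

lemma (in group) translate_number_attained:
  assumes "finite (carrier G)" "S \<subseteq> carrier G"
  shows "card S \<le> translate_number G S" "forces_translate G S (translate_number G S)"
    and "translate_number G S \<le> order G"
proof -
  have "\<one> <# S \<subseteq> A" if "A \<subseteq> carrier G" "card A = order G" for A
    using that assms card_subset_eq[of "carrier G" A] by (simp add: order_def lcos_mult_one)
  then have *: "card S \<le> order G \<and> forces_translate G S (order G)"
    using assms by (auto simp: forces_translate_def order_def card_mono)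
  show "card S \<le> translate_number G S" "forces_translate G S (translate_number G S)"
    using LeastI[where P = "\<lambda>N. card S \<le> N \<and> forces_translate G S N", OF *]
    by (simp_all add: translate_number_def)
  show "translate_number G S \<le> order G"
    unfolding translate_number_def by (rule Least_le) (rule *)
qed

end

theory Submission
  imports Defs
begin

text \<open>
  Both bounds count elements of the complement of \<open>A\<close>.

  Upper bound: every pair \<open>(c, s)\<close> with \<open>c \<notin> A\<close> and \<open>s \<in> S\<close> excludes just one translate,
  the one by \<open>c \<otimes> inv s\<close>.  If there are fewer than \<open>order G\<close> such pairs, then some translate
  of \<open>S\<close> is not excluded (\<open>exists_translate_subset\<close>).

  Lower bound: \<open>S\<close> is a union of cosets of its stabilizer \<open>H\<close>, and in an abelian group so is
  every translate of \<open>S\<close>.  A system of representatives of the cosets of \<open>H\<close> therefore meets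
  every translate (\<open>coset_representatives_meet_translates\<close>), and its complement is a set with
  \<open>order G - order G / card H\<close> elements that contains no translate.  Its subsets contain none
  either, so no smaller size forces a translate (\<open>forces_translate_mono\<close>).
\<close>

lemma (in group) exists_translate_subset:
  assumes fin: "finite (carrier G)"
    and S: "S \<subseteq> carrier G"
    and less: "card S * card (carrier G - A) < order G"
  shows "\<exists>g\<in>carrier G. g <# S \<subseteq> A"
proof -
  define excl where "excl = (\<lambda>(s, c). c \<otimes> inv s) ` (S \<times> (carrier G - A))"
  have "finite S"
    using fin S by (rule finite_subset[rotated])
  then have "card excl \<le> card (S \<times> (carrier G - A))"
    unfolding excl_def using fin by (intro card_image_le) simp
  also have "\<dots> < card (carrier G)"
    using less by (simp add: card_cartesian_product order_def)
  finally have "\<not> carrier G \<subseteq> excl"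
    using card_mono[of excl "carrier G"] \<open>finite S\<close> fin by (auto simp: excl_def)
  then obtain g where g: "g \<in> carrier G" "g \<notin> excl"
    by blast
  have "g \<otimes> s \<in> A" if s: "s \<in> S" for s
  proof (rule ccontr)
    assume "g \<otimes> s \<notin> A"
    moreover have "g = (g \<otimes> s) \<otimes> inv s"
      using g(1) s S by (simp add: m_assoc subset_iff)
    ultimately have "g \<in> excl"
      using g(1) s S by (force simp: excl_def image_iff)
    with g(2) show False ..
  qed
  then show ?thesis
    using g(1) by (auto simp: l_coset_def)
qed

text \<open>
  The hypothesis is \<open>card S * (order G - N) < order G\<close>, written without subtraction: the
  complement of a set of size \<open>N\<close> is too small to exclude every translate.  It is equivalent
  to \<open>N > (card S - 1) / card S * order G\<close>, and since \<open>card S \<le> order G\<close> it also yields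
  \<open>card S \<le> N\<close>.
\<close>

lemma (in group) translate_number_le:
  assumes fin: "finite (carrier G)"
    and S: "S \<subseteq> carrier G"
    and less: "card S * order G < card S * N + order G"
  shows "translate_number G S \<le> N"
proof -
  have "forces_translate G S N"
    unfolding forces_translate_def
  proof (intro allI impI, elim conjE)
    fix A assume A: "A \<subseteq> carrier G" "card A = N"
    have "card (carrier G - A) + N = order G"
      using A fin card_Diff_subset[of A "carrier G"] card_mono[of "carrier G" A]
      by (simp add: order_def finite_subset)
    then have "card S * card (carrier G - A) + card S * N = card S * order G"
      by (metis distrib_left)
    with less have "card S * card (carrier G - A) < order G"
      by linarith
    then show "\<exists>g\<in>carrier G. g <# S \<subseteq> A"
      by (rule exists_translate_subset[OF fin S])
  qed
  moreover have "card S \<le> N"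
  proof (rule ccontr)
    assume "\<not> card S \<le> N"
    then obtain m where m: "card S = Suc m" "N \<le> m"
      by (metis Suc_le_D not_less_eq_eq)
    have "card S \<le> order G"
      using S fin by (simp add: order_def card_mono)
    then have "m * Suc m \<le> m * order G"
      unfolding m(1) by (rule mult_le_mono2)
    moreover have "Suc m * N \<le> Suc m * m"
      using m(2) by (rule mult_le_mono2)
    ultimately show False
      using less m(1) by simp
  qed
  ultimately show ?thesis
    by (auto simp: translate_number_def intro: Least_le)
qed

lemma forces_translate_mono:
  assumes "forces_translate G S M" and "M \<le> N"
  shows "forces_translate G S N"
  unfolding forces_translate_def
proof (intro allI impI, elim conjE)
  fix A assume A: "A \<subseteq> carrier G" "card A = N"
  obtain B where B: "B \<subseteq> A" "card B = M"
    using obtain_subset_with_card_n[of M A] A(2) assms(2) by auto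
  have "B \<subseteq> carrier G"
    using B(1) A(1) by (rule subset_trans)
  then obtain g where "g \<in> carrier G" "g <#\<^bsub>G\<^esub> S \<subseteq> B"
    using assms(1) B(2) unfolding forces_translate_def by blast
  with B(1) show "\<exists>g\<in>carrier G. g <#\<^bsub>G\<^esub> S \<subseteq> A"
    by (intro bexI[of _ g]) (rule subset_trans)
qed

text \<open>
  The stabilizer of \<open>S\<close> also stabilizes every translate of \<open>S\<close>, because of commutativity:
  \<open>h \<otimes> (g \<otimes> s) = g \<otimes> (h \<otimes> s)\<close>.  Hence a translate contains, with \<open>g \<otimes> s\<close>, its whole
  coset, and in particular the representative chosen there.
\<close>

lemma (in comm_group) coset_representatives_meet_translates:
  assumes S: "S \<subseteq> carrier G" "S \<noteq> {}"
  obtains R where "R \<subseteq> carrier G"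
    and "card R * card (set_stabilizer G S) = order G"
    and "\<And>g. g \<in> carrier G \<Longrightarrow> (g <# S) \<inter> R \<noteq> {}"
proof -
  define H where "H = set_stabilizer G S"
  have H: "subgroup H G"
    unfolding H_def using S(1) by (rule set_stabilizer_subgroup)
  define rep where "rep C = (SOME x. x \<in> C)" for C :: "'a set"
  have rep: "rep C \<in> C" if "C \<in> rcosets H" for C
    using subgroup.rcosets_non_empty[OF H that] unfolding rep_def by (simp add: some_in_eq)
  have "inj_on rep (rcosets H)"
  proof (rule inj_onI)
    fix C D assume CD: "C \<in> rcosets H" "D \<in> rcosets H" "rep C = rep D"
    then have "C \<inter> D \<noteq> {}"
      using rep[OF CD(1)] rep[OF CD(2)] by auto
    then show "C = D"
      using rcos_disjoint[OF H] CD(1,2) by (auto simp: pairwise_def disjnt_def)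
  qed
  then have "card (rep ` (rcosets H)) * card H = order G"
    using lagrange[OF H] by (simp add: card_image)
  moreover have "rep ` (rcosets H) \<subseteq> carrier G"
    using rep rcosets_part_G[OF H] by blast
  moreover have "(g <# S) \<inter> rep ` (rcosets H) \<noteq> {}" if g: "g \<in> carrier G" for g
  proof -
    obtain s where s: "s \<in> S"
      using S(2) by blast
    have sG: "s \<in> carrier G"
      using s S(1) by blast
    have C: "H #> (g \<otimes> s) \<in> rcosets H"
      using g sG by (intro rcosetsI subgroup.subset[OF H]) auto
    then obtain h where h: "h \<in> H" "rep (H #> (g \<otimes> s)) = h \<otimes> (g \<otimes> s)"
      using rep[OF C] by (auto simp: r_coset_def)
    have hG: "h \<in> carrier G" and hS: "h <# S = S"
      using h(1) by (auto simp: H_def set_stabilizer_iff)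
    have "h \<otimes> s \<in> S"
      using s hS by (auto simp: l_coset_def)
    moreover have "h \<otimes> (g \<otimes> s) = g \<otimes> (h \<otimes> s)"
      using hG g sG by (rule m_lcomm)
    ultimately have "rep (H #> (g \<otimes> s)) \<in> g <# S"
      using h(2) by (auto simp: l_coset_def)
    with C show ?thesis
      by blast
  qed
  ultimately show ?thesis
    using that unfolding H_def by blast
qed

text \<open>
  The witness \<open>c\<close> is the index of the stabilizer; the complement of a system of coset
  representatives has \<open>order G - c\<close> elements and contains no translate of \<open>S\<close>.
\<close>

lemma (in comm_group) order_less_translate_number:
  assumes fin: "finite (carrier G)" and S: "S \<subseteq> carrier G" "S \<noteq> {}"
  obtains c where "c * card (set_stabilizer G S) = order G"
    and "order G < translate_number G S + c"
proof -
  obtain R where R: "R \<subseteq> carrier G" "card R * card (set_stabilizer G S) = order G"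
    "\<And>g. g \<in> carrier G \<Longrightarrow> (g <# S) \<inter> R \<noteq> {}"
    using coset_representatives_meet_translates[OF S] by metis
  have "\<not> forces_translate G S (card (carrier G - R))"
  proof
    assume "forces_translate G S (card (carrier G - R))"
    then obtain g where "g \<in> carrier G" "g <# S \<subseteq> carrier G - R"
      unfolding forces_translate_def by auto
    with R(3) show False
      by blast
  qed
  then have "card (carrier G - R) < translate_number G S"
    using forces_translate_mono translate_number_attained(2)[OF fin S(1)] not_less by metis
  moreover have "card (carrier G - R) = order G - card R"
    using R(1) fin by (simp add: order_def card_Diff_subset finite_subset)
  ultimately show ?thesis
    using R(2) by (intro that[of "card R"]) auto
qed

theorem theorem1:
  fixes G :: "('a, 'b) monoid_scheme" and S :: "'a set"
  assumes "comm_group G"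
    and "finite (carrier G)"
    and "S \<subseteq> carrier G"
    and "S \<noteq> {}"
  shows "(real (card (set_stabilizer G S)) - 1) / real (card (set_stabilizer G S))
             * real (order G) + 1
           \<le> real (translate_number G S)
       \<and> int (translate_number G S)
           \<le> \<lfloor>(real (card S) - 1) / real (card S) * real (order G)\<rfloor> + 1"
proof
  interpret comm_group G by fact
  have n: "order G > 0"
    using assms(2) by (simp add: order_gt_0_iff_finite)
  show "(real (card (set_stabilizer G S)) - 1) / real (card (set_stabilizer G S))
             * real (order G) + 1 \<le> real (translate_number G S)"
  proof -
    let ?h = "card (set_stabilizer G S)"
    obtain c where c: "c * ?h = order G" "order G < translate_number G S + c"
      using order_less_translate_number[OF assms(2-4)] .
    have "?h > 0"
      using c(1) n by (cases ?h) auto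
    then have "(real ?h - 1) / real ?h * real (order G) = real (order G) - real c"
      by (simp add: c(1)[symmetric] field_simps)
    with c(2) show ?thesis
      by linarith
  qed
  show "int (translate_number G S)
           \<le> \<lfloor>(real (card S) - 1) / real (card S) * real (order G)\<rfloor> + 1"
  proof -
    let ?k = "card S" and ?x = "(real (card S) - 1) / real (card S) * real (order G)"
    have k: "?k > 0"
      using assms(2-4) by (meson card_gt_0_iff finite_subset)
    then have "0 \<le> ?x"
      by simp
    define N where "N = nat (\<lfloor>?x\<rfloor> + 1)"
    have N: "int N = \<lfloor>?x\<rfloor> + 1"
      using \<open>0 \<le> ?x\<close> unfolding N_def by simp
    then have "?x < real N"
      by linarith
    then have "real ?k * real (order G) < real ?k * real N + real (order G)"
      using k by (simp add: field_simps)
    then have "?k * order G < ?k * N + order G"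
      by (metis of_nat_add of_nat_less_iff of_nat_mult)
    then have "translate_number G S \<le> N"
      by (rule translate_number_le[OF assms(2,3)])
    with N show ?thesis
      by linarith
  qed
qed

end
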